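(* The following are equivalent for every set $A\subseteq\omega$. (1) $A$ computes a function $B:\{0,1\}^*\to\omega$ which is a lower bound of the plain complexity $C$ (i.e. $B(x)\le C(x)$ for all $x$) and such that for all $n$ there are at most $2^n-1$ many $x$ with $B(x)<n$. (2) $A$ computes a function $F$ such that for all $n$, $F(n)$ is a binary string of length $n$ with $C(F(n))\ge n$. (3) $A$ computes a DNR function $D$ whose range is contained in a fixed finite set.
   Context: Fix an acceptable numbering $\varphi_0,\varphi_1,\dots$ of the partial recursive functions. $C$ denotes plain Kolmogorov complexity with respect to a fixed universal machine on binary strings. Natural numbers and binary strings are identified in a standard computable way when needed. A total function $D:\omega\to\omega$ is diagonally nonrecursive (DNR) if $D(x)\neq\varphi_x(x)$ for every $x$ with $\varphi_x(x)$ defined. *)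

theory Defs
  imports Main
begin

text \<open>Programs for the functions that are partial recursive in an oracle: the basic functions and
  the membership oracle, closed under composition, primitive recursion and minimisation. A program
  is run on a list of arguments; a basic function applied to the wrong number of arguments diverges.\<close>

datatype recf =
    Zero
  | Succ
  | Proj nat
  | Oracle
  | Comp recf "recf list"
  | PrimRec recf recf
  | Mu recf

fun eval :: "nat set \<Rightarrow> recf \<Rightarrow> nat list \<Rightarrow> nat option" where
  "eval A Zero xs = Some 0"
| "eval A Succ xs = (case xs of [x] \<Rightarrow> Some (Suc x) | _ \<Rightarrow> None)"
| "eval A (Proj i) xs = (if i < length xs then Some (xs ! i) else None)"
| "eval A Oracle xs = (case xs of [x] \<Rightarrow> Some (if x \<in> A then 1 else 0) | _ \<Rightarrow> None)"
| "eval A (Comp f gs) xs =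
     (if \<forall>g\<in>set gs. eval A g xs \<noteq> None
      then eval A f (map (\<lambda>g. the (eval A g xs)) gs) else None)"
| "eval A (PrimRec f g) xs =
     (case xs of [] \<Rightarrow> None
      | n # ys \<Rightarrow> rec_nat (eval A f ys) (\<lambda>m r. Option.bind r (\<lambda>v. eval A g (m # v # ys))) n)"
| "eval A (Mu f) xs =
     (if \<exists>n. eval A f (n # xs) = Some 0 \<and> (\<forall>m<n. eval A f (m # xs) \<noteq> None)
      then Some (LEAST n. eval A f (n # xs) = Some 0 \<and> (\<forall>m<n. eval A f (m # xs) \<noteq> None))
      else None)"

definition recursive_in :: "nat set \<Rightarrow> (nat \<Rightarrow> nat) \<Rightarrow> bool" where
  "recursive_in A f \<longleftrightarrow> (\<exists>p. \<forall>x. eval A p [x] = Some (f x))"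

text \<open>The empty oracle only contributes the constant zero function, so programs with that oracle
  compute exactly the (unrelativised) partial recursive functions.\<close>

definition partial_recursive :: "(nat \<Rightarrow> nat option) \<Rightarrow> bool" where
  "partial_recursive \<psi> \<longleftrightarrow> (\<exists>p. \<forall>x. eval {} p [x] = \<psi> x)"

definition partial_recursive2 :: "(nat \<Rightarrow> nat \<Rightarrow> nat option) \<Rightarrow> bool" where
  "partial_recursive2 \<psi> \<longleftrightarrow> (\<exists>p. \<forall>x y. eval {} p [x, y] = \<psi> x y)"

text \<open>Acceptability in the form of the enumeration and the s-m-n property; the latter, applied
  to functions \<open>\<psi>\<close> not depending on their first argument, also says that every partial recursive
  function occurs in the numbering.\<close>

definition acceptable_numbering :: "(nat \<Rightarrow> nat \<Rightarrow> nat option) \<Rightarrow> bool" where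
  "acceptable_numbering \<phi> \<longleftrightarrow>
     partial_recursive2 \<phi> \<and>
     (\<forall>\<psi>. partial_recursive2 \<psi> \<longrightarrow>
        (\<exists>s. recursive_in {} s \<and> (\<forall>e x. \<phi> (s e) x = \<psi> e x)))"

definition DNR :: "(nat \<Rightarrow> nat \<Rightarrow> nat option) \<Rightarrow> (nat \<Rightarrow> nat) \<Rightarrow> bool" where
  "DNR \<phi> D \<longleftrightarrow> (\<forall>x. \<phi> x x \<noteq> None \<longrightarrow> \<phi> x x \<noteq> Some (D x))"

text \<open>Binary strings are numbered in length-lexicographic order: \<open>\<sigma>\<close> is sent to \<open>m - 1\<close>, where \<open>m\<close>
  has the binary expansion \<open>1\<sigma>\<close>.\<close>

definition string_code :: "bool list \<Rightarrow> nat" where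
  "string_code \<sigma> = foldl (\<lambda>n b. 2 * n + (if b then 2 else 1)) 0 \<sigma>"

definition string_of :: "nat \<Rightarrow> bool list" where
  "string_of = inv string_code"

lemma string_code_Nil: "string_code [] = 0"
  by (simp add: string_code_def)

lemma string_code_snoc: "string_code (\<sigma> @ [b]) = 2 * string_code \<sigma> + (if b then 2 else 1)"
  by (simp add: string_code_def)

lemma bij_string_code: "bij string_code"
proof (rule bijI)
  have "string_code \<sigma> = string_code \<tau> \<Longrightarrow> \<sigma> = \<tau>" for \<sigma> \<tau>
  proof (induction \<sigma> arbitrary: \<tau> rule: rev_induct)
    case Nil
    then show ?case
      by (cases \<tau> rule: rev_cases) (auto simp: string_code_Nil string_code_snoc split: if_splits)
  next
    case (snoc b \<sigma>)
    then obtain c \<rho> where \<tau>: "\<tau> = \<rho> @ [c]"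
      by (cases \<tau> rule: rev_cases) (auto simp: string_code_Nil string_code_snoc split: if_splits)
    have eq: "2 * string_code \<sigma> + (if b then 2 else 1) = 2 * string_code \<rho> + (if c then 2 else 1)"
      using snoc.prems by (simp add: \<tau> string_code_snoc)
    have "b = c"
      using eq by (cases b; cases c; simp; presburger)
    with eq snoc.IH[of \<rho>] show ?case
      by (simp add: \<tau>)
  qed
  then show "inj string_code"
    by (rule injI)
  have "\<exists>\<sigma>. string_code \<sigma> = n" for n
  proof (induction n rule: less_induct)
    case (less n)
    show ?case
    proof (cases "n = 0")
      case True
      then show ?thesis using string_code_Nil by blast
    next
      case False
      then have "(n - 1) div 2 < n" by simp
      then obtain \<sigma> where "string_code \<sigma> = (n - 1) div 2"
        using less by blast
      with False have "string_code (\<sigma> @ [even n]) = n"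
        by (auto simp: string_code_snoc elim!: evenE oddE)
      then show ?thesis by blast
    qed
  qed
  then show "surj string_code"
    by (metis surjI)
qed

definition computes_nat_to_string :: "nat set \<Rightarrow> (nat \<Rightarrow> bool list) \<Rightarrow> bool" where
  "computes_nat_to_string A F \<longleftrightarrow> recursive_in A (\<lambda>n. string_code (F n))"

definition computes_string_to_nat :: "nat set \<Rightarrow> (bool list \<Rightarrow> nat) \<Rightarrow> bool" where
  "computes_string_to_nat A B \<longleftrightarrow> recursive_in A (\<lambda>n. B (string_of n))"

definition machine :: "(bool list \<Rightarrow> bool list option) \<Rightarrow> bool" where
  "machine M \<longleftrightarrow> partial_recursive (\<lambda>n. map_option string_code (M (string_of n)))"

text \<open>Universality in the sense of the invariance theorem (additive optimality): every machine is
  simulated with programs longer by at most a constant. Machines that are universal by adjunction,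
  \<open>U (\<rho> @ p) = M p\<close> for a string \<open>\<rho>\<close> depending on \<open>M\<close> only, are a special case.\<close>

definition universal_machine :: "(bool list \<Rightarrow> bool list option) \<Rightarrow> bool" where
  "universal_machine U \<longleftrightarrow>
     machine U \<and>
     (\<forall>M. machine M \<longrightarrow>
        (\<exists>c. \<forall>p x. M p = Some x \<longrightarrow> (\<exists>q. U q = Some x \<and> length q \<le> length p + c)))"

text \<open>The minimum exists for every \<open>x\<close> when \<open>U\<close> is universal, since \<open>U\<close> simulates the identity.\<close>

definition plain_complexity :: "(bool list \<Rightarrow> bool list option) \<Rightarrow> bool list \<Rightarrow> nat" where
  "plain_complexity U x = (LEAST n. \<exists>p. length p = n \<and> U p = Some x)"

end

theory Submission
  imports Defs "HOL-Library.Nat_Bijection"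
begin

section \<open>Closure properties of recursive functions\<close>

text \<open>From (1) to (2) by counting: fewer than 2^n strings have \<open>B\<close> below n, so
  some string x of length n has n \<le> \<open>B x\<close>, hence complexity at least n. Since
  \<open>B\<close> is computable from \<open>A\<close>, a search finds one
  (\<open>complex_strings_from_lower_bound\<close>).

  From (2) to (3), write \<langle>k, x\<rangle> for the code of a pair. If the string
  \<open>F (\<langle>k, x\<rangle> + k)\<close> ended in the k bits of \<phi>_x(x), its first
  \<langle>k, x\<rangle> bits would describe it: k and x can be read off from their length, and then
  \<phi>_x(x) supplies the rest. For k above the simulation constant this contradicts the complexity
  of the string. So the number formed by its last k bits differs from \<phi>_x(x), and these numbers
  stay below 2^k (\<open>DNR_from_complex_strings\<close>).

  From (3) to (1), the range is first reduced to two values by repeated halving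
  (\<open>DNR_halve_range\<close>, \<open>DNR_two_valued\<close>). The halving is not uniform: a
  case distinction decides which of two functions is diagonally nonrecursive. A two-valued DNR
  function answers every question whether \<open>U p = x\<close>, correctly whenever
  \<open>U p\<close> converges. The answers give an \<open>A\<close>-decidable single-valued
  extension of \<open>U\<close>. Every x has a program in it, so complexity relative to the
  extension is computable from \<open>A\<close>. It is at most C, and it is below n for at most as
  many strings as there are programs shorter than n
  (\<open>lower_bound_from_two_valued_DNR\<close>).

  The searches let \<open>A\<close> watch partial recursive computations converge. The required
  stage functions are built by induction on programs (\<open>enumerable_in_eval\<close>).\<close>

definition add_prog :: recf where
  "add_prog = PrimRec (Proj 0) (Comp Succ [Proj 1])"

definition pred_prog :: recf where
  "pred_prog = PrimRec Zero (Proj 0)"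

text \<open>Primitive recursion runs on the first argument, so the number subtracted comes
  first.\<close>

definition diff_prog :: recf where
  "diff_prog = PrimRec (Proj 0) (Comp pred_prog [Proj 1])"

definition mult_prog :: recf where
  "mult_prog = PrimRec Zero (Comp add_prog [Proj 1, Proj 2])"

definition triangle_prog :: recf where
  "triangle_prog = PrimRec Zero (Comp Succ [Comp add_prog [Proj 0, Proj 1]])"

definition pair_prog :: recf where
  "pair_prog = Comp add_prog [Comp triangle_prog [add_prog], Proj 0]"

text \<open>The code of (x, y) is \<open>triangle (x + y) + x\<close>, which is below
  \<open>triangle (x + y + 1)\<close>. The least n for which the code is below
  \<open>triangle (n + 1)\<close> is therefore x + y, and subtraction then yields x and y.\<close>

definition diagonal_prog :: recf where
  "diagonal_prog =
     Mu (Comp diff_prog [Comp triangle_prog [Comp Succ [Proj 0]], Comp Succ [Proj 1]])"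

definition fst_prog :: recf where
  "fst_prog = Comp diff_prog [Comp triangle_prog [diagonal_prog], Proj 0]"

definition snd_prog :: recf where
  "snd_prog = Comp diff_prog [fst_prog, diagonal_prog]"

section \<open>Values of the arithmetic and pairing programs\<close>

lemma eval_PrimRec_total:
  assumes "eval A f ys = Some a" and "\<And>m v. eval A g (m # v # ys) = Some (h m v)"
  shows "eval A (PrimRec f g) (n # ys) = Some (rec_nat a h n)"
proof -
  have "rec_nat (eval A f ys) (\<lambda>m r. Option.bind r (\<lambda>v. eval A g (m # v # ys))) n = Some (rec_nat a h n)"
    by (induction n) (simp_all add: assms)
  then show ?thesis by simp
qed

lemma eval_Mu_total:
  assumes "\<And>n. eval A f (n # xs) = Some (h n)" and "\<exists>n. h n = 0"
  shows "eval A (Mu f) xs = Some (LEAST n. h n = 0)"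
  using assms by simp

lemma eval_add: "eval A add_prog [x, y] = Some (x + y)"
proof -
  have "rec_nat y (\<lambda>m v. Suc v) x = x + y" by (induction x) auto
  then show ?thesis unfolding add_prog_def by (subst eval_PrimRec_total) auto
qed

lemma eval_pred: "eval A pred_prog [x] = Some (x - 1)"
proof -
  have "rec_nat 0 (\<lambda>m v. m) x = x - 1" by (cases x) auto
  then show ?thesis unfolding pred_prog_def by (subst eval_PrimRec_total) auto
qed

lemma eval_diff: "eval A diff_prog [y, x] = Some (x - y)"
proof -
  have "rec_nat x (\<lambda>m v. v - 1) y = x - y" by (induction y) auto
  then show ?thesis unfolding diff_prog_def
    by (subst eval_PrimRec_total[where h = "\<lambda>m v. v - 1"]) (auto simp: eval_pred)
qed

lemma eval_mult: "eval A mult_prog [x, y] = Some (x * y)"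
proof -
  have "rec_nat 0 (\<lambda>m v. v + y) x = x * y" by (induction x) auto
  then show ?thesis unfolding mult_prog_def
    by (subst eval_PrimRec_total[where h = "\<lambda>m v. v + y"]) (auto simp: eval_add)
qed

lemma eval_triangle: "eval A triangle_prog [x] = Some (triangle x)"
proof -
  have "rec_nat 0 (\<lambda>m v. Suc (m + v)) x = triangle x" by (induction x) auto
  then show ?thesis unfolding triangle_prog_def
    by (subst eval_PrimRec_total[where h = "\<lambda>m v. Suc (m + v)"]) (auto simp: eval_add)
qed

lemma eval_pair: "eval A pair_prog [x, y] = Some (prod_encode (x, y))"
  by (simp add: pair_prog_def eval_add eval_triangle prod_encode_def)

lemma triangle_mono: "m \<le> n \<Longrightarrow> triangle m \<le> triangle n"
  by (rule lift_Suc_mono_le[of triangle]) auto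

lemma eval_diagonal: "eval A diagonal_prog [prod_encode (x, y)] = Some (x + y)"
proof -
  have "(LEAST n. Suc (triangle (x + y) + x) - triangle (Suc n) = 0) = x + y"
  proof (rule Least_equality)
    fix n assume n: "Suc (triangle (x + y) + x) - triangle (Suc n) = 0"
    show "x + y \<le> n"
    proof (rule ccontr)
      assume "\<not> x + y \<le> n"
      then have "triangle (Suc n) \<le> triangle (x + y)" by (intro triangle_mono) simp
      with n show False by simp
    qed
  qed simp
  moreover have "\<exists>n. Suc (triangle (x + y) + x) - triangle (Suc n) = 0"
    by (rule exI[of _ "x + y"]) simp
  ultimately show ?thesis unfolding diagonal_prog_def
    by (subst eval_Mu_total[where h = "\<lambda>n. Suc (triangle (x + y) + x) - triangle (Suc n)"])
      (auto simp: eval_diff eval_triangle prod_encode_def simp del: triangle_Suc)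
qed

lemma eval_fst: "eval A fst_prog [z] = Some (fst (prod_decode z))"
proof (cases "prod_decode z")
  case (Pair x y)
  then have "z = prod_encode (x, y)" by (metis prod_decode_inverse)
  then show ?thesis
    by (simp add: fst_prog_def eval_diff eval_triangle eval_diagonal) (simp add: prod_encode_def)
qed

lemma eval_snd: "eval A snd_prog [z] = Some (snd (prod_decode z))"
proof (cases "prod_decode z")
  case (Pair x y)
  then have "z = prod_encode (x, y)" by (metis prod_decode_inverse)
  then show ?thesis
    by (simp add: snd_prog_def eval_diff eval_diagonal eval_fst)
qed

section \<open>Closure rules for unary total functions, with tuples passed as codes\<close>

named_theorems recursive_intros

lemma recursive_in_id [recursive_intros]: "recursive_in A (\<lambda>x. x)"
  unfolding recursive_in_def by (rule exI[of _ "Proj 0"]) simp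

lemma recursive_in_comp:
  assumes "recursive_in A f" and "recursive_in A g"
  shows "recursive_in A (\<lambda>x. f (g x))"
proof -
  obtain p q where "\<And>x. eval A p [x] = Some (f x)" "\<And>x. eval A q [x] = Some (g x)"
    using assms unfolding recursive_in_def by blast
  then have "\<And>x. eval A (Comp p [q]) [x] = Some (f (g x))" by simp
  then show ?thesis unfolding recursive_in_def by blast
qed

lemma recursive_in_comp2:
  assumes "\<And>x y. eval A p [x, y] = Some (h x y)" and "recursive_in A f" and "recursive_in A g"
  shows "recursive_in A (\<lambda>x. h (f x) (g x))"
proof -
  obtain q r where "\<And>x. eval A q [x] = Some (f x)" "\<And>x. eval A r [x] = Some (g x)"
    using assms unfolding recursive_in_def by blast
  then have "\<And>x. eval A (Comp p [q, r]) [x] = Some (h (f x) (g x))" by (simp add: assms(1))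
  then show ?thesis unfolding recursive_in_def by blast
qed

lemma recursive_in_Suc [recursive_intros]:
  "recursive_in A f \<Longrightarrow> recursive_in A (\<lambda>x. Suc (f x))"
  by (rule recursive_in_comp[of A Suc]) (auto simp: recursive_in_def intro!: exI[of _ Succ])

lemma recursive_in_const [recursive_intros]: "recursive_in A (\<lambda>x. c)"
proof (induction c)
  case 0
  show ?case unfolding recursive_in_def by (rule exI[of _ Zero]) simp
qed (rule recursive_in_Suc)

lemma recursive_in_add [recursive_intros]:
  "recursive_in A f \<Longrightarrow> recursive_in A g \<Longrightarrow> recursive_in A (\<lambda>x. f x + g x)"
  using recursive_in_comp2[OF eval_add] .

lemma recursive_in_diff [recursive_intros]:
  "recursive_in A f \<Longrightarrow> recursive_in A g \<Longrightarrow> recursive_in A (\<lambda>x. f x - g x)"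
  using recursive_in_comp2[OF eval_diff, of A g f] .

lemma recursive_in_mult [recursive_intros]:
  "recursive_in A f \<Longrightarrow> recursive_in A g \<Longrightarrow> recursive_in A (\<lambda>x. f x * g x)"
  using recursive_in_comp2[OF eval_mult] .

lemma recursive_in_prod_encode [recursive_intros]:
  "recursive_in A f \<Longrightarrow> recursive_in A g \<Longrightarrow> recursive_in A (\<lambda>x. prod_encode (f x, g x))"
  using recursive_in_comp2[OF eval_pair] .

lemma recursive_in_fst [recursive_intros]:
  "recursive_in A f \<Longrightarrow> recursive_in A (\<lambda>x. fst (prod_decode (f x)))"
  by (rule recursive_in_comp[of A "\<lambda>x. fst (prod_decode x)"])
    (auto simp: recursive_in_def eval_fst intro!: exI[of _ fst_prog])

lemma recursive_in_snd [recursive_intros]: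
  "recursive_in A f \<Longrightarrow> recursive_in A (\<lambda>x. snd (prod_decode (f x)))"
  by (rule recursive_in_comp[of A "\<lambda>x. snd (prod_decode x)"])
    (auto simp: recursive_in_def eval_snd intro!: exI[of _ snd_prog])

lemma recursive_in_rec_nat [recursive_intros]:
  assumes "recursive_in A a" and "recursive_in A f"
    and "recursive_in A (\<lambda>z. g (fst (prod_decode z)) (fst (prod_decode (snd (prod_decode z))))
                              (snd (prod_decode (snd (prod_decode z)))))"
  shows "recursive_in A (\<lambda>x. rec_nat (f x) (\<lambda>m r. g m r x) (a x))"
proof -
  obtain p q r where p: "\<And>x. eval A p [x] = Some (a x)" and q: "\<And>x. eval A q [x] = Some (f x)"
    and r: "\<And>z. eval A r [z] = Some (g (fst (prod_decode z)) (fst (prod_decode (snd (prod_decode z))))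
                              (snd (prod_decode (snd (prod_decode z)))))"
    using assms unfolding recursive_in_def by blast
  let ?s = "Comp r [Comp pair_prog [Proj 0, Comp pair_prog [Proj 1, Proj 2]]]"
  have "eval A (PrimRec q ?s) [n, x] = Some (rec_nat (f x) (\<lambda>m r. g m r x) n)" for n x
    by (rule eval_PrimRec_total) (simp_all add: q r eval_pair)
  then have "\<And>x. eval A (Comp (PrimRec q ?s) [p, Proj 0]) [x] = Some (rec_nat (f x) (\<lambda>m r. g m r x) (a x))"
    by (simp add: p del: eval.simps(6))
  then show ?thesis unfolding recursive_in_def by blast
qed

text \<open>The value 0 stands for truth: minimisation then searches for truth, a conjunction
  becomes a sum and a disjunction a product.\<close>

definition decidable_in :: "nat set \<Rightarrow> (nat \<Rightarrow> bool) \<Rightarrow> bool" where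
  "decidable_in A P \<longleftrightarrow> recursive_in A (\<lambda>x. if P x then 0 else 1)"

lemma if_0_1_eq_0: "(if p then 0 else 1) = (0::nat) \<longleftrightarrow> p" "1 - (if p then 0 else 1) = (0::nat) \<longleftrightarrow> \<not> p"
  by auto

lemma decidable_in_eq_0:
  "recursive_in A f \<Longrightarrow> decidable_in A (\<lambda>x. f x = 0)"
proof -
  assume f: "recursive_in A f"
  have "(\<lambda>x. if f x = 0 then 0 else 1) = (\<lambda>x. 1 - (1 - f x))" by auto
  then show ?thesis unfolding decidable_in_def using f
    by (simp only:) (intro recursive_intros)
qed

lemma decidable_in_le [recursive_intros]:
  "recursive_in A f \<Longrightarrow> recursive_in A g \<Longrightarrow> decidable_in A (\<lambda>x. f x \<le> g x)"
  using decidable_in_eq_0[of A "\<lambda>x. f x - g x"] by (simp add: recursive_intros)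

lemma decidable_in_less [recursive_intros]:
  "recursive_in A f \<Longrightarrow> recursive_in A g \<Longrightarrow> decidable_in A (\<lambda>x. f x < g x)"
  using decidable_in_le[of A "\<lambda>x. Suc (f x)" g] by (simp add: recursive_intros less_eq_Suc_le)

lemma decidable_in_conj [recursive_intros]:
  assumes "decidable_in A P" and "decidable_in A Q"
  shows "decidable_in A (\<lambda>x. P x \<and> Q x)"
  using decidable_in_eq_0[OF recursive_in_add[OF assms[unfolded decidable_in_def]]]
  by (simp only: add_is_0 if_0_1_eq_0)

lemma decidable_in_not [recursive_intros]:
  assumes "decidable_in A P"
  shows "decidable_in A (\<lambda>x. \<not> P x)"
  using decidable_in_eq_0[OF recursive_in_diff[OF recursive_in_const[of A 1] assms[unfolded decidable_in_def]]]
  by (simp only: if_0_1_eq_0)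

lemma decidable_in_disj [recursive_intros]:
  assumes "decidable_in A P" and "decidable_in A Q"
  shows "decidable_in A (\<lambda>x. P x \<or> Q x)"
  using decidable_in_eq_0[OF recursive_in_mult[OF assms[unfolded decidable_in_def]]]
  by (simp only: mult_is_0 if_0_1_eq_0)

lemma decidable_in_eq [recursive_intros]:
  assumes "recursive_in A f" and "recursive_in A g"
  shows "decidable_in A (\<lambda>x. f x = g x)"
proof -
  have "decidable_in A (\<lambda>x. f x \<le> g x \<and> g x \<le> f x)" by (intro recursive_intros assms)
  then show ?thesis by (simp add: eq_iff)
qed

lemma recursive_in_if [recursive_intros]:
  assumes "decidable_in A P" and "recursive_in A f" and "recursive_in A g"
  shows "recursive_in A (\<lambda>x. if P x then f x else g x)"
proof -
  have "(\<lambda>x. if P x then f x else g x) =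
    (\<lambda>x. (1 - (if P x then 0 else 1)) * f x + (if P x then 0 else 1) * g x)" by auto
  then show ?thesis using assms unfolding decidable_in_def
    by (simp only:) (intro recursive_intros)
qed

lemma decidable_in_ball_less [recursive_intros]:
  assumes "recursive_in A a"
    and "decidable_in A (\<lambda>z. P (fst (prod_decode z)) (snd (prod_decode z)))"
  shows "decidable_in A (\<lambda>x. \<forall>m<a x. P m x)"
proof -
  \<comment> \<open>The recursion counts the failures below n.\<close>
  let ?c = "\<lambda>n x. rec_nat (0::nat) (\<lambda>m r. r + (if P m x then 0 else 1)) n"
  have "?c n x = 0 \<longleftrightarrow> (\<forall>m<n. P m x)" for n x
    by (induction n) (auto simp: less_Suc_eq)
  moreover have "decidable_in A (\<lambda>z. P (fst (prod_decode z)) (snd (prod_decode (snd (prod_decode z)))))"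
    using recursive_in_comp[OF assms(2)[unfolded decidable_in_def], of
        "\<lambda>z. prod_encode (fst (prod_decode z), snd (prod_decode (snd (prod_decode z))))"]
    unfolding decidable_in_def by (simp add: recursive_intros)
  then have "decidable_in A (\<lambda>x. ?c (a x) x = 0)"
    by (intro decidable_in_eq_0 recursive_intros assms(1))
  ultimately show ?thesis by simp
qed

lemma recursive_in_Least [recursive_intros]:
  assumes "decidable_in A (\<lambda>z. P (fst (prod_decode z)) (snd (prod_decode z)))"
    and "\<And>x. \<exists>n. P n x"
  shows "recursive_in A (\<lambda>x. LEAST n. P n x)"
proof -
  obtain p where p: "\<And>z. eval A p [z] =
      Some (if P (fst (prod_decode z)) (snd (prod_decode z)) then 0 else 1)"
    using assms(1) unfolding decidable_in_def recursive_in_def by blast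
  have "eval A (Mu (Comp p [pair_prog])) [x] = Some (LEAST n. (if P n x then 0 else 1) = (0::nat))" for x
    by (rule eval_Mu_total) (use assms(2) in \<open>auto simp: p eval_pair\<close>)
  then have "eval A (Mu (Comp p [pair_prog])) [x] = Some (LEAST n. P n x)" for x
    by (simp del: eval.simps(7) cong: if_cong)
  then show ?thesis unfolding recursive_in_def by blast
qed

lemma recursive_in_div [recursive_intros]:
  assumes "recursive_in A f" and "recursive_in A g"
  shows "recursive_in A (\<lambda>x. f x div g x)"
proof -
  \<comment> \<open>The disjunct \<open>g x = 0\<close> keeps the search total and stops it at 0,
    the value of division by zero.\<close>
  have eq: "f x div g x = (LEAST q. g x = 0 \<or> f x < g x * Suc q)" for x
  proof (cases "g x = 0")
    case False
    show ?thesis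
    proof (rule Least_equality[symmetric])
      show "g x = 0 \<or> f x < g x * Suc (f x div g x)"
        using False by (simp add: dividend_less_times_div)
      fix q assume "g x = 0 \<or> f x < g x * Suc q"
      then show "f x div g x \<le> q"
        using False by (metis less_mult_imp_div_less mult.commute less_Suc_eq_le)
    qed
  qed simp
  have "\<exists>q. g x = 0 \<or> f x < g x * Suc q" for x
    by (rule exI[of _ "f x"]) (cases "g x"; simp)
  with assms show ?thesis unfolding eq
    by (intro recursive_intros recursive_in_comp[OF assms(1)] recursive_in_comp[OF assms(2)])
qed

lemma recursive_in_mod [recursive_intros]:
  "recursive_in A f \<Longrightarrow> recursive_in A g \<Longrightarrow> recursive_in A (\<lambda>x. f x mod g x)"
  unfolding minus_div_mult_eq_mod[symmetric] by (intro recursive_intros)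

lemma recursive_in_power [recursive_intros]:
  assumes "recursive_in A f" and "recursive_in A g"
  shows "recursive_in A (\<lambda>x. f x ^ g x)"
proof -
  have eq: "b ^ n = rec_nat 1 (\<lambda>m r. r * b) n" for b n :: nat
    by (induction n) auto
  show ?thesis unfolding eq
    by (intro recursive_intros recursive_in_comp[OF assms(1)] assms)
qed

lemma recursive_in_fun_comp2:
  assumes "recursive_in A (\<lambda>z. h (fst (prod_decode z)) (snd (prod_decode z)))"
    and "recursive_in A f" and "recursive_in A g"
  shows "recursive_in A (\<lambda>x. h (f x) (g x))"
  using recursive_in_comp[OF assms(1) recursive_in_prod_encode[OF assms(2,3)]] by simp

section \<open>Closure rules for partial recursive functions\<close>

lemma partial_recursive_total: "recursive_in {} f \<Longrightarrow> partial_recursive (\<lambda>x. Some (f x))"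
  unfolding partial_recursive_def recursive_in_def .

lemma partial_recursive_comp:
  assumes "partial_recursive \<psi>" and "recursive_in {} f"
  shows "partial_recursive (\<lambda>x. \<psi> (f x))"
proof -
  obtain p q where "\<And>x. eval {} p [x] = \<psi> x" "\<And>x. eval {} q [x] = Some (f x)"
    using assms unfolding partial_recursive_def recursive_in_def by blast
  then have "\<And>x. eval {} (Comp p [q]) [x] = \<psi> (f x)" by simp
  then show ?thesis unfolding partial_recursive_def by blast
qed

lemma partial_recursive_bind:
  assumes "partial_recursive \<psi>"
    and "partial_recursive (\<lambda>z. \<chi> (fst (prod_decode z)) (snd (prod_decode z)))"
  shows "partial_recursive (\<lambda>x. Option.bind (\<psi> x) (\<lambda>v. \<chi> v x))"
proof -
  obtain p q where p: "\<And>x. eval {} p [x] = \<psi> x"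
    and q: "\<And>z. eval {} q [z] = \<chi> (fst (prod_decode z)) (snd (prod_decode z))"
    using assms unfolding partial_recursive_def by blast
  have "eval {} (Comp q [Comp pair_prog [p, Proj 0]]) [x] = Option.bind (\<psi> x) (\<lambda>v. \<chi> v x)" for x
    by (cases "\<psi> x") (simp_all add: p q eval_pair)
  then show ?thesis unfolding partial_recursive_def by blast
qed

lemma partial_recursive2_iff:
  "partial_recursive2 \<psi> \<longleftrightarrow>
     partial_recursive (\<lambda>z. \<psi> (fst (prod_decode z)) (snd (prod_decode z)))"
proof
  assume "partial_recursive2 \<psi>"
  then obtain p where "\<And>x y. eval {} p [x, y] = \<psi> x y"
    unfolding partial_recursive2_def by blast
  then have "\<And>z. eval {} (Comp p [fst_prog, snd_prog]) [z] =
      \<psi> (fst (prod_decode z)) (snd (prod_decode z))"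
    by (simp add: eval_fst eval_snd)
  then show "partial_recursive (\<lambda>z. \<psi> (fst (prod_decode z)) (snd (prod_decode z)))"
    unfolding partial_recursive_def by blast
next
  assume "partial_recursive (\<lambda>z. \<psi> (fst (prod_decode z)) (snd (prod_decode z)))"
  then obtain p where "\<And>z. eval {} p [z] = \<psi> (fst (prod_decode z)) (snd (prod_decode z))"
    unfolding partial_recursive_def by blast
  then have "\<And>x y. eval {} (Comp p [pair_prog]) [x, y] = \<psi> x y"
    by (simp add: eval_pair)
  then show "partial_recursive2 \<psi>"
    unfolding partial_recursive2_def by blast
qed

section \<open>Stagewise enumeration of partial recursive functions\<close>

text \<open>The value \<open>v\<close> found by stage \<open>t\<close> is reported as \<open>Suc v\<close>; \<open>0\<close> means that there is none yet.\<close>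

definition stagewise_in :: "nat set \<Rightarrow> (nat \<Rightarrow> nat option) \<Rightarrow> (nat \<Rightarrow> nat \<Rightarrow> nat) \<Rightarrow> bool" where
  "stagewise_in A \<psi> T \<longleftrightarrow>
     recursive_in A (\<lambda>w. T (fst (prod_decode w)) (snd (prod_decode w))) \<and>
     (\<forall>s t x v. s \<le> t \<longrightarrow> T s x = Suc v \<longrightarrow> T t x = Suc v) \<and>
     (\<forall>x v. \<psi> x = Some v \<longleftrightarrow> (\<exists>t. T t x = Suc v))"

lemma stagewise_in_recursive:
  assumes "stagewise_in A \<psi> T" and "recursive_in A f" and "recursive_in A g"
  shows "recursive_in A (\<lambda>x. T (f x) (g x))"
  using assms unfolding stagewise_in_def by (blast intro: recursive_in_fun_comp2)

lemma stagewise_in_mono: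
  "stagewise_in A \<psi> T \<Longrightarrow> T s x = Suc v \<Longrightarrow> s \<le> t \<Longrightarrow> T t x = Suc v"
  unfolding stagewise_in_def by blast

lemma stagewise_in_eq_Some:
  "stagewise_in A \<psi> T \<Longrightarrow> \<psi> x = Some v \<longleftrightarrow> (\<exists>t. T t x = Suc v)"
  unfolding stagewise_in_def by blast

lemma stagewise_in_eq_Some_prod_encode:
  "stagewise_in A (\<lambda>z. \<chi> (fst (prod_decode z)) (snd (prod_decode z))) T \<Longrightarrow>
     \<chi> x y = Some v \<longleftrightarrow> (\<exists>t. T t (prod_encode (x, y)) = Suc v)"
  by (drule stagewise_in_eq_Some[where x = "prod_encode (x, y)" and v = v]) simp

definition enumerable_in :: "nat set \<Rightarrow> (nat \<Rightarrow> nat option) \<Rightarrow> bool" where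
  "enumerable_in A \<psi> \<longleftrightarrow> (\<exists>T. stagewise_in A \<psi> T)"

lemma enumerable_in_None: "enumerable_in A (\<lambda>x. None)"
  unfolding enumerable_in_def stagewise_in_def
  by (rule exI[of _ "\<lambda>t x. 0"]) (simp add: recursive_intros)

lemma enumerable_in_total:
  assumes "recursive_in A f"
  shows "enumerable_in A (\<lambda>x. Some (f x))"
proof -
  have "recursive_in A (\<lambda>w. Suc (f (snd (prod_decode w))))"
    by (intro recursive_intros recursive_in_comp[OF assms])
  then show ?thesis
    unfolding enumerable_in_def stagewise_in_def by (intro exI[of _ "\<lambda>t x. Suc (f x)"]) simp
qed

text \<open>Both computations get the same stage. Values once found persist, so the maximum of two
  stages serves both.\<close>

lemma enumerable_in_bind:
  assumes "enumerable_in A \<psi>"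
    and "enumerable_in A (\<lambda>z. \<chi> (fst (prod_decode z)) (snd (prod_decode z)))"
  shows "enumerable_in A (\<lambda>x. Option.bind (\<psi> x) (\<lambda>v. \<chi> v x))"
proof -
  obtain S T where S: "stagewise_in A \<psi> S"
    and T: "stagewise_in A (\<lambda>z. \<chi> (fst (prod_decode z)) (snd (prod_decode z))) T"
    using assms unfolding enumerable_in_def by blast
  let ?V = "\<lambda>t x. if S t x = 0 then 0 else T t (prod_encode (S t x - 1, x))"
  have V: "?V t x = Suc w \<longleftrightarrow> (\<exists>v. S t x = Suc v \<and> T t (prod_encode (v, x)) = Suc w)" for t x w
    by (cases "S t x") auto
  have "recursive_in A (\<lambda>w. ?V (fst (prod_decode w)) (snd (prod_decode w)))"
    by (intro recursive_intros stagewise_in_recursive[OF S] stagewise_in_recursive[OF T])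
  moreover have "?V t x = Suc w" if "s \<le> t" "?V s x = Suc w" for s t x w
    using that stagewise_in_mono[OF S _ that(1)] stagewise_in_mono[OF T _ that(1)] unfolding V by blast
  moreover have "Option.bind (\<psi> x) (\<lambda>v. \<chi> v x) = Some w \<longleftrightarrow> (\<exists>t. ?V t x = Suc w)" for x w
  proof -
    have "S s x = Suc v \<Longrightarrow> T t z = Suc w \<Longrightarrow>
        S (max s t) x = Suc v \<and> T (max s t) z = Suc w" for s t v z
      using stagewise_in_mono[OF S] stagewise_in_mono[OF T] by (meson max.cobounded1 max.cobounded2)
    then show ?thesis
      unfolding V bind_eq_Some_conv stagewise_in_eq_Some[OF S] stagewise_in_eq_Some_prod_encode[OF T]
      by metis
  qed
  ultimately have "stagewise_in A (\<lambda>x. Option.bind (\<psi> x) (\<lambda>v. \<chi> v x)) ?V"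
    unfolding stagewise_in_def by blast
  then show ?thesis unfolding enumerable_in_def by blast
qed

lemma enumerable_in_comp:
  assumes "enumerable_in A \<psi>" and "recursive_in A f"
  shows "enumerable_in A (\<lambda>x. \<psi> (f x))"
proof -
  obtain T where T: "stagewise_in A \<psi> T"
    using assms unfolding enumerable_in_def by blast
  have "recursive_in A (\<lambda>w. T (fst (prod_decode w)) (f (snd (prod_decode w))))"
    by (intro stagewise_in_recursive[OF T] recursive_in_comp[OF assms(2)] recursive_intros)
  then have "stagewise_in A (\<lambda>x. \<psi> (f x)) (\<lambda>t x. T t (f x))"
    using T unfolding stagewise_in_def by blast
  then show ?thesis unfolding enumerable_in_def by blast
qed

text \<open>All rounds of the recursion share one stage, and a round without a value yet passes its
  0 on to the later rounds.\<close>

lemma enumerable_in_rec_nat: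
  assumes "enumerable_in A \<psi>"
    and "enumerable_in A (\<lambda>z. \<chi> (fst (prod_decode z)) (fst (prod_decode (snd (prod_decode z))))
                              (snd (prod_decode (snd (prod_decode z)))))"
    and "recursive_in A a"
  shows "enumerable_in A (\<lambda>x. rec_nat (\<psi> x) (\<lambda>m r. Option.bind r (\<lambda>v. \<chi> m v x)) (a x))"
proof -
  let ?\<chi> = "\<lambda>z. \<chi> (fst (prod_decode z)) (fst (prod_decode (snd (prod_decode z))))
                 (snd (prod_decode (snd (prod_decode z))))"
  obtain S T where S: "stagewise_in A \<psi> S" and T: "stagewise_in A ?\<chi> T"
    using assms(1,2) unfolding enumerable_in_def by blast
  define V where "V t x n =
    rec_nat (S t x) (\<lambda>m r. if r = 0 then 0 else T t (prod_encode (m, prod_encode (r - 1, x)))) n" for t x n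
  have V0: "V t x 0 = S t x" and
    VSuc: "V t x (Suc n) = Suc w \<longleftrightarrow>
      (\<exists>v. V t x n = Suc v \<and> T t (prod_encode (n, prod_encode (v, x))) = Suc w)" for t x n w
    by (cases "V t x n"; simp add: V_def)+
  let ?r = "\<lambda>x n. rec_nat (\<psi> x) (\<lambda>m r. Option.bind r (\<lambda>v. \<chi> m v x)) n"
  have "recursive_in A (\<lambda>w. V (fst (prod_decode w)) (snd (prod_decode w)) (a (snd (prod_decode w))))"
    unfolding V_def
    by (intro recursive_intros stagewise_in_recursive[OF S] stagewise_in_recursive[OF T]
        recursive_in_comp[OF assms(3)])
  moreover have mono: "V t x n = Suc w" if "s \<le> t" "V s x n = Suc w" for s t x n w
    using that(2)
  proof (induction n arbitrary: w)
    case 0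
    then show ?case using stagewise_in_mono[OF S _ \<open>s \<le> t\<close>] unfolding V0 by blast
  next
    case (Suc n)
    then show ?case using stagewise_in_mono[OF T _ \<open>s \<le> t\<close>] unfolding VSuc by blast
  qed
  moreover have "?r x n = Some w \<longleftrightarrow> (\<exists>t. V t x n = Suc w)" for x n w
  proof (induction n arbitrary: w)
    case 0
    show ?case using stagewise_in_eq_Some[OF S] by (simp add: V0)
  next
    case (Suc n)
    have \<chi>: "\<chi> n v x = Some w \<longleftrightarrow> (\<exists>t. T t (prod_encode (n, prod_encode (v, x))) = Suc w)" for v
      using stagewise_in_eq_Some[OF T, of "prod_encode (n, prod_encode (v, x))"] by simp
    have "V s x n = Suc v \<Longrightarrow> T t z = Suc w \<Longrightarrow>
        V (max s t) x n = Suc v \<and> T (max s t) z = Suc w" for s t v z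
      using mono stagewise_in_mono[OF T] by (meson max.cobounded1 max.cobounded2)
    then show ?case
      unfolding VSuc old.nat.simps(7) bind_eq_Some_conv Suc \<chi> by metis
  qed
  ultimately have "stagewise_in A (\<lambda>x. ?r x (a x)) (\<lambda>t x. V t x (a x))"
    unfolding stagewise_in_def by blast
  then show ?thesis unfolding enumerable_in_def by blast
qed

text \<open>The least zero with all earlier values defined is the only n with value 0 and all
  earlier values defined and positive. This form is confirmed at a finite stage and is never
  revoked.\<close>

lemma enumerable_in_Mu:
  assumes "enumerable_in A (\<lambda>z. \<chi> (fst (prod_decode z)) (snd (prod_decode z)))"
  shows "enumerable_in A (\<lambda>x. if \<exists>n. \<chi> n x = Some 0 \<and> (\<forall>m<n. \<chi> m x \<noteq> None)
      then Some (LEAST n. \<chi> n x = Some 0 \<and> (\<forall>m<n. \<chi> m x \<noteq> None)) else None)"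
proof -
  let ?\<chi> = "\<lambda>z. \<chi> (fst (prod_decode z)) (snd (prod_decode z))"
  let ?P = "\<lambda>n x. \<chi> n x = Some 0 \<and> (\<forall>m<n. \<chi> m x \<noteq> None)"
  let ?\<mu> = "\<lambda>x. if \<exists>n. ?P n x then Some (LEAST n. ?P n x) else None"
  obtain T where T: "stagewise_in A ?\<chi> T"
    using assms unfolding enumerable_in_def by blast
  note \<chi> = stagewise_in_eq_Some_prod_encode[OF T] and T_mono = stagewise_in_mono[OF T]
  \<comment> \<open>Reports are shifted by one: 1 means the value 0 was found, and 2 or more means a
    positive value was found.\<close>
  define W where "W t x n \<longleftrightarrow>
    T t (prod_encode (n, x)) = 1 \<and> (\<forall>m<n. 2 \<le> T t (prod_encode (m, x)))" for t x n
  have W_unique: "n = n'" if "W t x n" "W t x n'" for t x n n'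
    using that unfolding W_def by (metis linorder_neqE_nat numeral_le_one_iff semiring_norm(69))
  have W_mono: "W t x n" if "s \<le> t" "W s x n" for s t x n
  proof -
    have "2 \<le> T t z" if "2 \<le> T s z" for z
      using T_mono[OF _ \<open>s \<le> t\<close>, of z "T s z - 1"] that by simp
    moreover have "T t z = 1" if "T s z = 1" for z
      using T_mono[OF _ \<open>s \<le> t\<close>, of z 0] that by simp
    ultimately show ?thesis using \<open>W s x n\<close> unfolding W_def by blast
  qed
  \<comment> \<open>Stage t examines only n < t; the alternative \<open>n = t\<close> makes the
    search total and signals failure.\<close>
  define V where "V t x = (if (LEAST n. n = t \<or> W t x n) < t then Suc (LEAST n. n = t \<or> W t x n) else 0)" for t x
  have V: "V t x = Suc n \<longleftrightarrow> n < t \<and> W t x n" for t x n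
  proof
    assume a: "V t x = Suc n"
    have "(LEAST n. n = t \<or> W t x n) = t \<or> W t x (LEAST n. n = t \<or> W t x n)"
      by (rule LeastI[of _ t]) simp
    with a show "n < t \<and> W t x n" unfolding V_def by (auto split: if_splits)
  next
    assume a: "n < t \<and> W t x n"
    then have "(LEAST n. n = t \<or> W t x n) = n"
      by (intro Least_equality) (auto dest: W_unique)
    with a show "V t x = Suc n" unfolding V_def by simp
  qed
  have "recursive_in A (\<lambda>w. V (fst (prod_decode w)) (snd (prod_decode w)))"
    unfolding V_def W_def by (intro recursive_intros stagewise_in_recursive[OF T]) auto
  moreover have "V t x = Suc n" if "s \<le> t" "V s x = Suc n" for s t x n
    using that W_mono unfolding V by auto
  moreover have "?\<mu> x = Some n \<longleftrightarrow> (\<exists>t. V t x = Suc n)" for x n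
  proof -
    let ?Q = "\<lambda>n. \<chi> n x = Some 0 \<and> (\<forall>m<n. \<exists>v. \<chi> m x = Some (Suc v))"
    have Q: "?Q n \<longleftrightarrow> (\<exists>t. n < t \<and> W t x n)"
    proof
      assume q: "?Q n"
      obtain s where s: "T s (prod_encode (n, x)) = Suc 0" using q \<chi> by blast
      have "\<forall>m. \<exists>t. m < n \<longrightarrow> 2 \<le> T t (prod_encode (m, x))"
        using q unfolding \<chi> by (metis Suc_le_mono le0 numeral_2_eq_2)
      then obtain u where u: "\<And>m. m < n \<Longrightarrow> 2 \<le> T (u m) (prod_encode (m, x))" by metis
      \<comment> \<open>The sum exceeds each of the finitely many stages needed, and
        \<open>Suc n\<close> secures \<open>n < t\<close>.\<close>
      define t where "t = Suc (n + s + sum u {..<n})"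
      have "T t (prod_encode (n, x)) = Suc 0" by (rule T_mono[OF s]) (simp add: t_def)
      moreover have "2 \<le> T t (prod_encode (m, x))" if "m < n" for m
      proof -
        have "u m \<le> t" using member_le_sum[of m "{..<n}" u] that by (simp add: t_def)
        then have "T t (prod_encode (m, x)) = T (u m) (prod_encode (m, x))"
          using T_mono[of "u m" "prod_encode (m, x)" "T (u m) (prod_encode (m, x)) - 1" t] u[OF that] by simp
        then show ?thesis using u[OF that] by simp
      qed
      ultimately have "n < t \<and> W t x n" by (simp add: W_def t_def)
      then show "\<exists>t. n < t \<and> W t x n" ..
    next
      assume "\<exists>t. n < t \<and> W t x n"
      then obtain t where "W t x n" by blast
      then have "T t (prod_encode (n, x)) = Suc 0"
        and "\<And>m. m < n \<Longrightarrow> T t (prod_encode (m, x)) = Suc (Suc (T t (prod_encode (m, x)) - 2))"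
        unfolding W_def by auto
      then show "?Q n" unfolding \<chi> by blast
    qed
    have "?\<mu> x = Some n \<longleftrightarrow> ?Q n"
    proof
      assume a: "?\<mu> x = Some n"
      then have n: "n = (LEAST n. ?P n x)" and e: "\<exists>n. ?P n x" by (auto split: if_splits)
      have p: "?P n x" unfolding n using e by (rule LeastI_ex)
      have "\<exists>v. \<chi> m x = Some (Suc v)" if m: "m < n" for m
      proof -
        obtain v where v: "\<chi> m x = Some v" using p m by auto
        have "\<not> ?P m x" using m unfolding n by (rule not_less_Least)
        then have "\<chi> m x \<noteq> Some 0" using p m by auto
        with v show ?thesis by (cases v) auto
      qed
      with p show "?Q n" by blast
    next
      assume q: "?Q n"
      have "(LEAST n. ?P n x) = n"
      proof (rule Least_equality)
        show "?P n x" using q by auto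
        fix m assume "?P m x"
        then show "n \<le> m" using q by (metis Zero_neq_Suc leI option.inject)
      qed
      moreover have "?P n x" using q by auto
      ultimately show "?\<mu> x = Some n" by auto
    qed
    then show ?thesis unfolding Q V .
  qed
  ultimately have "stagewise_in A ?\<mu> V"
    unfolding stagewise_in_def by blast
  then show ?thesis unfolding enumerable_in_def by blast
qed

section \<open>Running programs stage by stage\<close>

fun args :: "nat \<Rightarrow> nat \<Rightarrow> nat list" where
  "args 0 z = []"
| "args (Suc n) z = fst (prod_decode z) # args n (snd (prod_decode z))"

lemma length_args [simp]: "length (args n z) = n"
  by (induction n arbitrary: z) auto

lemma recursive_in_args_nth: "i < n \<Longrightarrow> recursive_in A (\<lambda>z. args n z ! i)"
proof (induction n arbitrary: i)
  case (Suc n)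
  show ?case
  proof (cases i)
    case 0
    then show ?thesis by (simp add: recursive_intros)
  next
    case (Suc j)
    with Suc.prems Suc.IH[of j] show ?thesis
      by (auto intro!: recursive_in_comp[of A "\<lambda>z. args n z ! j"] recursive_intros)
  qed
qed simp

text \<open>Programs act on lists, stage functions on numbers; \<open>args n\<close> decodes a
  number into a list of length n. The induction needs all n at once, as composition, recursion and
  minimisation change the arity. The programs run with the empty oracle, while the stage functions
  are recursive in \<open>A\<close>.\<close>

lemma enumerable_in_eval: "enumerable_in A (\<lambda>z. eval {} p (args n z))"
proof (induction p arbitrary: n)
  case Zero
  show ?case by (simp add: enumerable_in_total recursive_intros)
next
  case Succ
  show ?case
  proof (cases "n = 1")
    case True
    then show ?thesis by (simp add: enumerable_in_total recursive_intros)
  next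
    case False
    then have "eval {} Succ (args n z) = None" for z
      by (auto split: list.split simp: length_Suc_conv dest: arg_cong[where f = length])
    then show ?thesis by (simp only: enumerable_in_None)
  qed
next
  case (Proj i)
  show ?case
    by (cases "i < n") (simp_all add: enumerable_in_total recursive_in_args_nth enumerable_in_None)
next
  case Oracle
  show ?case
  proof (cases "n = 1")
    case True
    then show ?thesis by (simp add: enumerable_in_total recursive_intros)
  next
    case False
    then have "eval {} Oracle (args n z) = None" for z
      by (auto split: list.split dest: arg_cong[where f = length])
    then show ?thesis by (simp only: enumerable_in_None)
  qed
next
  case (Comp f gs)
  \<comment> \<open>Composition is strict: \<psi> yields a code of the tuple of all inner values and
    diverges as soon as one of them does.\<close>
  have "\<exists>\<psi>. enumerable_in A \<psi> \<and> (\<forall>z. if \<forall>g\<in>set gs. eval {} g (args n z) \<noteq> None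
      then \<exists>w. \<psi> z = Some w \<and> args (length gs) w = map (\<lambda>g. the (eval {} g (args n z))) gs
      else \<psi> z = None)"
    using Comp.IH(2)
  proof (induction gs)
    case Nil
    show ?case
      by (rule exI[of _ "\<lambda>z. Some 0"]) (simp add: enumerable_in_total recursive_intros)
  next
    case (Cons g gs)
    then obtain \<psi> where \<psi>: "enumerable_in A \<psi>"
      "\<And>z. if \<forall>g\<in>set gs. eval {} g (args n z) \<noteq> None
        then \<exists>w. \<psi> z = Some w \<and> args (length gs) w = map (\<lambda>g. the (eval {} g (args n z))) gs
        else \<psi> z = None"
      by (auto simp del: not_None_eq)
    let ?\<psi> = "\<lambda>z. Option.bind (\<psi> z) (\<lambda>w. Option.bind (eval {} g (args n z)) (\<lambda>v. Some (prod_encode (v, w))))"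
    have "enumerable_in A (\<lambda>z. eval {} g (args n z))" using Cons.prems by simp
    note g = enumerable_in_comp[OF this]
    have "enumerable_in A ?\<psi>"
      by (intro enumerable_in_bind \<psi>(1) enumerable_in_total recursive_intros g)
    moreover have "if \<forall>g\<in>set (g # gs). eval {} g (args n z) \<noteq> None
        then \<exists>w. ?\<psi> z = Some w \<and>
          args (length (g # gs)) w = map (\<lambda>g. the (eval {} g (args n z))) (g # gs)
        else ?\<psi> z = None" for z
      using \<psi>(2)[of z] by (cases "\<psi> z"; cases "eval {} g (args n z)") (auto split: if_splits)
    ultimately show ?case by blast
  qed
  then obtain \<psi> where \<psi>: "enumerable_in A \<psi>"
    "\<And>z. if \<forall>g\<in>set gs. eval {} g (args n z) \<noteq> None
      then \<exists>w. \<psi> z = Some w \<and> args (length gs) w = map (\<lambda>g. the (eval {} g (args n z))) gs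
      else \<psi> z = None"
    by blast
  have "eval {} (Comp f gs) (args n z) = Option.bind (\<psi> z) (\<lambda>w. eval {} f (args (length gs) w))" for z
    using \<psi>(2)[of z] by (auto split: if_splits)
  moreover have "enumerable_in A (\<lambda>z. Option.bind (\<psi> z) (\<lambda>w. eval {} f (args (length gs) w)))"
    by (intro enumerable_in_bind \<psi>(1) enumerable_in_comp[OF Comp.IH(1)] recursive_intros)
  ultimately show ?case by simp
next
  case (PrimRec f g)
  show ?case
  proof (cases n)
    case 0
    then show ?thesis by (simp add: enumerable_in_None)
  next
    case (Suc k)
    have "eval {} (PrimRec f g) (args n z) =
        rec_nat (eval {} f (args k (snd (prod_decode z))))
          (\<lambda>m r. Option.bind r (\<lambda>v. eval {} g (args (Suc (Suc k)) (prod_encode (m, prod_encode (v, snd (prod_decode z)))))))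
          (fst (prod_decode z))" for z
      by (simp add: Suc)
    moreover have "enumerable_in A (\<lambda>z.
        rec_nat (eval {} f (args k (snd (prod_decode z))))
          (\<lambda>m r. Option.bind r (\<lambda>v. eval {} g (args (Suc (Suc k)) (prod_encode (m, prod_encode (v, snd (prod_decode z)))))))
          (fst (prod_decode z)))"
      by (intro enumerable_in_rec_nat enumerable_in_comp[OF PrimRec.IH(1)]
          enumerable_in_comp[OF PrimRec.IH(2)] recursive_intros)
    ultimately show ?thesis by presburger
  qed
next
  case (Mu f)
  have "enumerable_in A (\<lambda>x. eval {} f (fst (prod_decode x) # args n (snd (prod_decode x))))"
    using Mu[of "Suc n"] by simp
  from enumerable_in_Mu[OF this] show ?case by simp
qed

lemma partial_recursive_enumerable_in: "partial_recursive \<psi> \<Longrightarrow> enumerable_in A \<psi>"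
proof -
  assume "partial_recursive \<psi>"
  then obtain p where p: "\<And>x. eval {} p [x] = \<psi> x" unfolding partial_recursive_def by blast
  have "enumerable_in A (\<lambda>x. eval {} p (args 1 (prod_encode (x, 0))))"
    by (intro enumerable_in_comp[OF enumerable_in_eval] recursive_intros)
  then show ?thesis by (simp add: p)
qed

text \<open>A program may behave differently when its oracle is replaced. The value is therefore
  taken from the first stage, computed with \<open>A\<close>, that reports one.\<close>

lemma recursive_in_if_recursive:
  assumes "recursive_in {} f"
  shows "recursive_in A f"
proof -
  obtain T where T: "stagewise_in A (\<lambda>x. Some (f x)) T"
    using partial_recursive_enumerable_in[OF partial_recursive_total[OF assms]]
    unfolding enumerable_in_def by blast
  let ?t = "\<lambda>x. LEAST t. T t x \<noteq> 0"
  have ex: "\<exists>t. T t x = Suc (f x)" and un: "T t x = Suc v \<Longrightarrow> v = f x" for t x v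
    using stagewise_in_eq_Some[OF T, of x v] stagewise_in_eq_Some[OF T, of x "f x"] by auto
  have ex': "\<exists>t. T t x \<noteq> 0" for x using ex[of x] by (metis Zero_not_Suc)
  then have "T (?t x) x \<noteq> 0" for x by (rule LeastI_ex)
  then have "f x = T (?t x) x - 1" for x
    using un[of "?t x" x] by (metis diff_Suc_1 not0_implies_Suc)
  then have "f = (\<lambda>x. T (?t x) x - 1)" ..
  moreover have "recursive_in A (\<lambda>x. T (?t x) x - 1)"
    using ex' by (intro recursive_intros stagewise_in_recursive[OF T])
  ultimately show ?thesis by metis
qed

section \<open>Diagonally nonrecursive functions with bounded range\<close>

lemma DNR_iff: "DNR \<phi> D \<longleftrightarrow> (\<forall>x. \<phi> x x \<noteq> Some (D x))"
  unfolding DNR_def by auto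

lemma partial_recursive_diagonal:
  assumes "acceptable_numbering \<phi>"
  shows "partial_recursive (\<lambda>x. \<phi> x x)"
proof -
  have "partial_recursive (\<lambda>z. \<phi> (fst (prod_decode z)) (snd (prod_decode z)))"
    using assms by (simp add: acceptable_numbering_def partial_recursive2_iff)
  from partial_recursive_comp[OF this, of "\<lambda>x. prod_encode (x, x)"] show ?thesis
    by (simp add: recursive_intros)
qed

text \<open>The s-m-n property is applied to \<psi> with a dummy second argument, so
  \<open>s e\<close> is an index of a constant function. A DNR function composed with
  \<open>s\<close> thus avoids \<psi> everywhere.\<close>

lemma acceptable_numbering_diagonal:
  assumes "acceptable_numbering \<phi>" and "partial_recursive \<psi>"
  obtains s where "recursive_in A s" and "\<And>e. \<phi> (s e) (s e) = \<psi> e"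
proof -
  have "partial_recursive2 (\<lambda>e x. \<psi> e)"
    unfolding partial_recursive2_iff by (intro partial_recursive_comp[OF assms(2)] recursive_intros)
  then obtain s where "recursive_in {} s" "\<And>e x. \<phi> (s e) x = \<psi> e"
    using assms(1) unfolding acceptable_numbering_def by metis
  then show ?thesis using that recursive_in_if_recursive by blast
qed

text \<open>Let \<open>(u, v)\<close> be the pair coded by the value of \<open>D\<close> at an index for the pair
  \<open>(\<phi>\<^sub>a(a), \<phi>\<^sub>b(b))\<close>, so that one of its components is wrong. Either for some \<open>a\<close> no \<open>b\<close> makes
  \<open>v\<close> right, and then \<open>v\<close> is a diagonally nonrecursive function of \<open>b\<close>; or for every \<open>a\<close> a search
  finds some \<open>b\<close> that makes \<open>v\<close> right, and the corresponding \<open>u\<close> is one of \<open>a\<close>.\<close>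

lemma DNR_halve_range:
  assumes acc: "acceptable_numbering \<phi>"
    and D: "recursive_in A D" "DNR \<phi> D" "\<And>x. D x < 2 * k"
  shows "(\<exists>D'. recursive_in A D' \<and> DNR \<phi> D' \<and> (\<forall>x. D' x < 2)) \<or>
         (\<exists>D'. recursive_in A D' \<and> DNR \<phi> D' \<and> (\<forall>x. D' x < k))"
proof -
  \<comment> \<open>The pair (u, v) is coded as u + 2 v and decoded by \<open>mod 2\<close> and
    \<open>div 2\<close>, so a bound 2 k on the code bounds v by k.\<close>
  let ?\<psi> = "\<lambda>e. Option.bind (\<phi> (fst (prod_decode e)) (fst (prod_decode e))) (\<lambda>u.
      Option.bind (\<phi> (snd (prod_decode e)) (snd (prod_decode e))) (\<lambda>v. Some (u + 2 * v)))"
  note diag = partial_recursive_diagonal[OF acc]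
  have "partial_recursive ?\<psi>"
    by (intro partial_recursive_bind partial_recursive_total partial_recursive_comp[OF diag]
        recursive_intros)
  then obtain s where s: "recursive_in A s" "\<And>e. \<phi> (s e) (s e) = ?\<psi> e"
    using acceptable_numbering_diagonal[OF acc] by blast
  define f where "f a b = D (s (prod_encode (a, b)))" for a b
  have f_rec: "recursive_in A (\<lambda>x. f (g x) (h x))" if "recursive_in A g" "recursive_in A h" for g h
    unfolding f_def
    by (intro recursive_in_comp[OF D(1)] recursive_in_comp[OF s(1)] recursive_intros that)
  have f_wrong: "\<phi> a a \<noteq> Some (f a b mod 2) \<or> \<phi> b b \<noteq> Some (f a b div 2)" for a b
  proof (rule ccontr)
    assume "\<not> ?thesis"
    then have "\<phi> (s (prod_encode (a, b))) (s (prod_encode (a, b))) = Some (f a b)"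
      by (simp add: s(2))
    then show False using D(2) unfolding f_def DNR_iff by blast
  qed
  show ?thesis
  proof (cases "\<exists>a. \<forall>b. \<phi> b b \<noteq> Some (f a b div 2)")
    case True
    then obtain a where "DNR \<phi> (\<lambda>b. f a b div 2)" unfolding DNR_iff by blast
    moreover have "recursive_in A (\<lambda>b. f a b div 2)" by (intro recursive_intros f_rec)
    moreover have "f a b div 2 < k" for b using D(3)[of "s (prod_encode (a, b))"] by (simp add: f_def)
    ultimately show ?thesis by blast
  next
    case False
    obtain T where T: "stagewise_in A (\<lambda>x. \<phi> x x) T"
      using partial_recursive_enumerable_in[OF diag] unfolding enumerable_in_def by blast
    \<comment> \<open>The search runs over pairs w of a stage and a candidate b, since convergence
      at b cannot be decided.\<close>
    let ?P = "\<lambda>w a. T (fst (prod_decode w)) (snd (prod_decode w)) = Suc (f a (snd (prod_decode w)) div 2)"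
    let ?b = "\<lambda>a. snd (prod_decode (LEAST w. ?P w a))"
    have ex: "\<exists>w. ?P w a" for a
    proof -
      obtain b where "\<phi> b b = Some (f a b div 2)" using False by blast
      then obtain t where "T t b = Suc (f a b div 2)" using stagewise_in_eq_Some[OF T] by blast
      then show ?thesis by (intro exI[of _ "prod_encode (t, b)"]) simp
    qed
    then have "?P (LEAST w. ?P w a) a" for a by (rule LeastI_ex)
    then have "\<phi> (?b a) (?b a) = Some (f a (?b a) div 2)" for a
      using stagewise_in_eq_Some[OF T] by blast
    then have "DNR \<phi> (\<lambda>a. f a (?b a) mod 2)"
      unfolding DNR_iff using f_wrong by blast
    moreover have "recursive_in A (\<lambda>a. f a (?b a) mod 2)"
      by (intro recursive_intros f_rec stagewise_in_recursive[OF T] ex)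
    ultimately show ?thesis by (meson mod_less_divisor zero_less_numeral)
  qed
qed

lemma DNR_two_valued:
  assumes acc: "acceptable_numbering \<phi>"
    and "recursive_in A D" "DNR \<phi> D" "\<And>x. D x < 2 ^ j"
  shows "\<exists>D'. recursive_in A D' \<and> DNR \<phi> D' \<and> (\<forall>x. D' x < 2)"
  using assms(2-4)
proof (induction j arbitrary: D)
  case 0
  then show ?case by (intro exI[of _ D]) (auto intro: less_trans)
next
  case (Suc j)
  then show ?case using DNR_halve_range[OF acc, of A D "2 ^ j"] by auto
qed

section \<open>Strings and complexity\<close>

lemma string_code_string_of [simp]: "string_code (string_of n) = n"
  unfolding string_of_def by (simp add: bij_string_code bij_is_surj surj_f_inv_f)

lemma string_of_string_code [simp]: "string_of (string_code \<sigma>) = \<sigma>"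
  unfolding string_of_def by (simp add: bij_string_code bij_is_inj)

text \<open>\<open>Suc (string_code \<sigma>)\<close> has the binary expansion 1\<sigma>, so its
  size determines the length of \<sigma>.\<close>

lemma string_code_bounds:
  "2 ^ length \<sigma> \<le> Suc (string_code \<sigma>) \<and> Suc (string_code \<sigma>) < 2 * 2 ^ length \<sigma>"
  by (induction \<sigma> rule: rev_induct) (auto simp: string_code_Nil string_code_snoc)

lemma length_string_of_le_iff: "length (string_of m) \<le> l \<longleftrightarrow> Suc m < 2 * 2 ^ l"
proof
  assume "length (string_of m) \<le> l"
  then have "(2::nat) ^ length (string_of m) \<le> 2 ^ l" by (rule power_increasing) simp
  then show "Suc m < 2 * 2 ^ l"
    using string_code_bounds[of "string_of m"] unfolding string_code_string_of by linarith
next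
  assume "Suc m < 2 * 2 ^ l"
  then have "(2::nat) ^ length (string_of m) < 2 ^ Suc l"
    using string_code_bounds[of "string_of m"] by simp
  then show "length (string_of m) \<le> l" by (simp add: power_strict_increasing_iff del: power_Suc)
qed

lemma length_string_of_less_iff: "length (string_of m) < l \<longleftrightarrow> Suc m < 2 ^ l"
  by (cases l) (simp_all add: length_string_of_le_iff less_Suc_eq_le)

lemma length_string_of_eq_iff: "length (string_of m) = l \<longleftrightarrow> 2 ^ l \<le> Suc m \<and> Suc m < 2 * 2 ^ l"
  using length_string_of_le_iff[of m l] length_string_of_less_iff[of m l] by auto

lemma recursive_in_length_string_of [recursive_intros]:
  assumes "recursive_in A f"
  shows "recursive_in A (\<lambda>x. length (string_of (f x)))"
proof -
  have "length (string_of m) = (LEAST l. Suc m < 2 * 2 ^ l)" for m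
    unfolding length_string_of_le_iff[symmetric] by (rule Least_equality[symmetric]) auto
  moreover have "\<exists>l. Suc m < 2 * 2 ^ l" for m
    using length_string_of_le_iff by blast
  ultimately show ?thesis
    by (simp only:) (intro recursive_intros recursive_in_comp[OF assms])
qed

lemma length_string_of_mono: "m \<le> n \<Longrightarrow> length (string_of m) \<le> length (string_of n)"
  using length_string_of_le_iff by (meson Suc_le_mono le_less_trans order_refl)

lemma strings_shorter: "finite {m. length (string_of m) < n}" "card {m. length (string_of m) < n} = 2 ^ n - 1"
proof -
  have "{m. length (string_of m) < n} = {..<2 ^ n - 1}"
    by (auto simp: length_string_of_less_iff)
  then show "finite {m. length (string_of m) < n}" "card {m. length (string_of m) < n} = 2 ^ n - 1"
    by simp_all
qed

lemma card_strings_of_length: "card {x :: bool list. length x = n} = 2 ^ n"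
  using card_lists_length_eq[of "UNIV :: bool set" n] by simp

lemma plain_complexity_le: "U q = Some x \<Longrightarrow> plain_complexity U x \<le> length q"
  unfolding plain_complexity_def by (rule Least_le) blast

text \<open>Simulating the identity machine provides a program for x, so the minimum defining the
  complexity is attained.\<close>

lemma universal_machine_surj:
  assumes "universal_machine U"
  obtains p where "U p = Some x" and "length p = plain_complexity U x"
proof -
  have "machine Some"
    unfolding machine_def by (simp add: partial_recursive_total recursive_intros)
  then obtain c where "\<forall>p y. Some p = Some y \<longrightarrow> (\<exists>q. U q = Some y \<and> length q \<le> length p + c)"
    using assms unfolding universal_machine_def by blast
  then obtain q where q: "U q = Some x" by blast
  have "\<exists>p. length p = plain_complexity U x \<and> U p = Some x"
    unfolding plain_complexity_def
    by (rule LeastI[of "\<lambda>n. \<exists>p. length p = n \<and> U p = Some x" "length q"]) (use q in blast)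
  then show ?thesis using that by blast
qed

section \<open>Lower bounds, complex strings and diagonally nonrecursive functions\<close>

text \<open>There are 2^n strings of length n, and at most 2^n - 1 strings have \<open>B\<close>
  below n.\<close>

lemma complex_strings_from_lower_bound:
  assumes "computes_string_to_nat A B" and le: "\<And>x. B x \<le> plain_complexity U x"
    and card: "\<And>n. finite {x. B x < n} \<and> card {x. B x < n} \<le> 2 ^ n - 1"
  shows "\<exists>F. computes_nat_to_string A F \<and> (\<forall>n. length (F n) = n \<and> plain_complexity U (F n) \<ge> n)"
proof -
  have B: "recursive_in A (\<lambda>m. B (string_of m))"
    using assms(1) unfolding computes_string_to_nat_def .
  let ?P = "\<lambda>m n. length (string_of m) = n \<and> n \<le> B (string_of m)"
  let ?F = "\<lambda>n. string_of (LEAST m. ?P m n)"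
  have ex: "\<exists>m. ?P m n" for n
  proof -
    have "\<not> {x. length x = n} \<subseteq> {x. B x < n}"
    proof
      assume "{x. length x = n} \<subseteq> {x. B x < n}"
      then have "(2::nat) ^ n \<le> 2 ^ n - 1"
        using card[of n] card_mono card_strings_of_length[of n] by (metis le_trans)
      moreover have "(0::nat) < 2 ^ n" by simp
      ultimately show False by linarith
    qed
    then obtain x where "length x = n" "n \<le> B x" using not_less by blast
    then show ?thesis by (intro exI[of _ "string_code x"]) simp
  qed
  then have F: "?P (LEAST m. ?P m n) n" for n by (rule LeastI_ex)
  have "computes_nat_to_string A ?F"
    unfolding computes_nat_to_string_def string_code_string_of
    by (intro recursive_intros recursive_in_comp[OF B] ex)
  moreover have "length (?F n) = n \<and> plain_complexity U (?F n) \<ge> n" for n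
    using F[of n] le[of "?F n"] by linarith
  ultimately show ?thesis by blast
qed

text \<open>A program of length \<open>\<langle>k, x\<rangle>\<close> is prolonged by the \<open>k\<close> bits of \<open>\<phi>\<^sub>x(x)\<close>. As \<open>k\<close> and \<open>x\<close> are read off
  from the length, the simulation constant of this machine does not depend on \<open>k\<close>. If \<open>k\<close> exceeds the
  constant, a complex string of length \<open>\<langle>k, x\<rangle> + k\<close> cannot end in the \<open>k\<close> bits of \<open>\<phi>\<^sub>x(x)\<close>.\<close>

lemma DNR_from_complex_strings:
  assumes acc: "acceptable_numbering \<phi>" and U: "universal_machine U"
    and "computes_nat_to_string A F"
    and F: "\<And>n. length (F n) = n \<and> plain_complexity U (F n) \<ge> n"
  shows "\<exists>D. recursive_in A D \<and> DNR \<phi> D \<and> (\<exists>E. finite E \<and> range D \<subseteq> E)"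
proof -
  let ?k = "\<lambda>m. fst (prod_decode (length (string_of m)))"
  let ?x = "\<lambda>m. snd (prod_decode (length (string_of m)))"
  \<comment> \<open>\<open>Suc m\<close> reads as 1\<sigma> in binary, so for v < 2^k the result
    codes \<sigma> followed by the k bits of v. Only such v matter below.\<close>
  let ?\<mu> = "\<lambda>m. Option.bind (\<phi> (?x m) (?x m)) (\<lambda>v. Some (Suc m * 2 ^ ?k m + v - 1))"
  define M where "M p = map_option string_of (?\<mu> (string_code p))" for p
  have "partial_recursive ?\<mu>"
    by (intro partial_recursive_bind partial_recursive_total
        partial_recursive_comp[OF partial_recursive_diagonal[OF acc]] recursive_intros)
  then have "machine M"
    by (simp add: machine_def M_def option.map_comp o_def option.map_ident)
  then obtain c where c: "\<And>p x. M p = Some x \<Longrightarrow> \<exists>q. U q = Some x \<and> length q \<le> length p + c"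
    using U unfolding universal_machine_def by blast
  define k where "k = Suc c"
  define n where "n x = prod_encode (k, x) + k" for x
  define D where "D x = Suc (string_code (F (n x))) mod 2 ^ k" for x
  have code_F: "recursive_in A (\<lambda>n. string_code (F n))"
    using assms(3) unfolding computes_nat_to_string_def .
  have "recursive_in A D"
    unfolding D_def n_def by (intro recursive_intros recursive_in_comp[OF code_F])
  moreover have "\<phi> x x \<noteq> Some (D x)" for x
  proof
    assume \<phi>: "\<phi> x x = Some (D x)"
    let ?w = "Suc (string_code (F (n x)))"
    let ?l = "prod_encode (k, x)"
    have w: "2 ^ ?l * 2 ^ k \<le> ?w" "?w < 2 * 2 ^ ?l * 2 ^ k"
      using string_code_bounds[of "F (n x)"] F[of "n x"] by (simp_all add: n_def power_add)
    \<comment> \<open>\<open>?w\<close> reads as 1 followed by \<open>F (n x)\<close>; dropping its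
      last k bits leaves 1 followed by the string that \<open>m\<close> codes.\<close>
    define m where "m = ?w div 2 ^ k - 1"
    have "2 ^ ?l \<le> ?w div 2 ^ k" "?w div 2 ^ k < 2 * 2 ^ ?l"
      using w by (simp_all add: less_eq_div_iff_mult_less_eq less_mult_imp_div_less)
    moreover have "(0::nat) < 2 ^ ?l" by simp
    ultimately have m: "Suc m = ?w div 2 ^ k" and l: "length (string_of m) = ?l"
      unfolding length_string_of_eq_iff m_def by linarith+
    have "Suc m * 2 ^ k + D x = ?w"
      unfolding m D_def by (rule div_mult_mod_eq)
    then have "M (string_of m) = Some (F (n x))"
      by (simp add: M_def l \<phi> del: mult_Suc)
    then obtain q where "U q = Some (F (n x))" "length q \<le> ?l + c"
      using c l by metis
    then have "plain_complexity U (F (n x)) < n x"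
      using plain_complexity_le[of U q] by (fastforce simp: n_def k_def)
    then show False using F[of "n x"] by simp
  qed
  moreover have "range D \<subseteq> {..<2 ^ k}" by (auto simp: D_def)
  ultimately show ?thesis unfolding DNR_iff by blast
qed

text \<open>A two-valued diagonally nonrecursive function computes a set \<open>R\<close> that contains the pairs \<open>(p, x)\<close>
  with \<open>U p = x\<close> and omits those for which \<open>U p\<close> is defined and different from \<open>x\<close>. Reading off the
  output of \<open>p\<close> as the least \<open>x\<close> with \<open>(p, x) \<in> R\<close> extends \<open>U\<close>, and the complexity relative to the
  extension is the required lower bound, the count being that of the programs of length below \<open>n\<close>.\<close>

lemma lower_bound_from_two_valued_DNR:
  assumes acc: "acceptable_numbering \<phi>" and U: "universal_machine U"
    and D: "recursive_in A D" "DNR \<phi> D" "\<And>x. D x < 2"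
  shows "\<exists>B. computes_string_to_nat A B \<and> (\<forall>x. B x \<le> plain_complexity U x) \<and>
             (\<forall>n. finite {x. B x < n} \<and> card {x. B x < n} \<le> 2 ^ n - 1)"
proof -
  let ?U = "\<lambda>m. map_option string_code (U (string_of m))"
  \<comment> \<open>The values are reversed, 0 for a correct guess and 1 for a wrong one:
    \<open>D\<close> has to differ, so it is 1 on correct and 0 on wrong guesses.\<close>
  let ?\<psi> = "\<lambda>e. Option.bind (?U (fst (prod_decode e))) (\<lambda>y. Some (if y = snd (prod_decode e) then 0 else 1 :: nat))"
  have "partial_recursive ?U" using U unfolding universal_machine_def machine_def by blast
  note U_comp = partial_recursive_comp[OF this]
  have "partial_recursive ?\<psi>"
    by (intro partial_recursive_bind partial_recursive_total U_comp recursive_intros)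
  then obtain s where s: "recursive_in A s" "\<And>e. \<phi> (s e) (s e) = ?\<psi> e"
    using acceptable_numbering_diagonal[OF acc] by blast
  define R where "R m x \<longleftrightarrow> D (s (prod_encode (m, x))) = 1" for m x
  have R_rec: "decidable_in A (\<lambda>z. R (f z) (g z))" if "recursive_in A f" "recursive_in A g" for f g
    unfolding R_def
    by (intro recursive_intros recursive_in_comp[OF D(1)] recursive_in_comp[OF s(1)] that)
  have R: "R m x \<longleftrightarrow> y = x" if "?U m = Some y" for m x y
  proof -
    let ?e = "prod_encode (m, x)"
    have "\<phi> (s ?e) (s ?e) = Some (if y = x then 0 else 1)"
      unfolding s(2) prod_encode_inverse fst_conv snd_conv that bind.bind_lunit ..
    moreover have "\<phi> (s ?e) (s ?e) \<noteq> Some (D (s ?e))" using D(2) unfolding DNR_iff by blast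
    ultimately have "D (s ?e) \<noteq> (if y = x then 0 else 1)" by auto
    then show ?thesis using D(3)[of "s ?e"] unfolding R_def by (auto split: if_splits)
  qed
  define V where "V m x \<longleftrightarrow> R m x \<and> (\<forall>x'<x. \<not> R m x')" for m x
  have V_unique: "V m x \<Longrightarrow> V m y \<Longrightarrow> x = y" for m x y
    unfolding V_def by (metis linorder_neqE_nat)
  have V: "V (string_code p) (string_code x)" if "U p = Some x" for p x
    using R[of "string_code p" "string_code x"] that unfolding V_def by auto
  \<comment> \<open>The numbering is length-lexicographic, so the least code also gives the shortest
    program.\<close>
  define P where "P x = (LEAST m. V m x)" for x
  have ex: "\<exists>m. V m x" for x
    using universal_machine_surj[OF U, of "string_of x"] V by (metis string_code_string_of)
  then have P: "V (P x) x" for x unfolding P_def by (rule LeastI_ex)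
  define B where "B \<sigma> = length (string_of (P (string_code \<sigma>)))" for \<sigma>
  have "recursive_in A (\<lambda>n. B (string_of n))"
    unfolding B_def P_def string_code_string_of using ex unfolding V_def
    by (intro recursive_intros R_rec)
  moreover have "B x \<le> plain_complexity U x" for x
  proof -
    obtain p where p: "U p = Some x" "length p = plain_complexity U x"
      using universal_machine_surj[OF U] .
    have "P (string_code x) \<le> string_code p"
      unfolding P_def by (rule Least_le) (rule V[OF p(1)])
    from length_string_of_mono[OF this] show ?thesis by (simp add: B_def p(2))
  qed
  moreover have "finite {x. B x < n} \<and> card {x. B x < n} \<le> 2 ^ n - 1" for n
  proof -
    have inj: "inj_on (\<lambda>x. P (string_code x)) {x. B x < n}"
      by (rule inj_onI) (metis P V_unique string_of_string_code)
    have sub: "(\<lambda>x. P (string_code x)) ` {x. B x < n} \<subseteq> {m. length (string_of m) < n}"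
      by (auto simp: B_def)
    show ?thesis
      using inj_on_finite[OF inj sub] card_inj_on_le[OF inj sub] by (simp add: strings_shorter)
  qed
  ultimately show ?thesis unfolding computes_string_to_nat_def by blast
qed

lemma lower_bound_from_DNR:
  assumes acc: "acceptable_numbering \<phi>" and "universal_machine U"
    and D: "recursive_in A D" "DNR \<phi> D" and E: "finite E" "range D \<subseteq> E"
  shows "\<exists>B. computes_string_to_nat A B \<and> (\<forall>x. B x \<le> plain_complexity U x) \<and>
             (\<forall>n. finite {x. B x < n} \<and> card {x. B x < n} \<le> 2 ^ n - 1)"
proof -
  have "D x < 2 ^ Max E" for x
    using E by (meson Max_ge less_exp order_le_less_trans rangeI subsetD)
  from DNR_two_valued[OF acc D this] show ?thesis
    using lower_bound_from_two_valued_DNR[OF assms(1,2)] by blast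
qed

theorem theorem4p1:
  fixes \<phi> :: "nat \<Rightarrow> nat \<Rightarrow> nat option"
    and U :: "bool list \<Rightarrow> bool list option"
    and A :: "nat set"
  assumes "acceptable_numbering \<phi>"
    and "universal_machine U"
  shows "((\<exists>B :: bool list \<Rightarrow> nat. computes_string_to_nat A B \<and>
             (\<forall>x. B x \<le> plain_complexity U x) \<and>
             (\<forall>n. finite {x. B x < n} \<and> card {x. B x < n} \<le> 2 ^ n - 1)) \<longleftrightarrow>
          (\<exists>F :: nat \<Rightarrow> bool list. computes_nat_to_string A F \<and>
             (\<forall>n. length (F n) = n \<and> plain_complexity U (F n) \<ge> n))) \<and>
         ((\<exists>F :: nat \<Rightarrow> bool list. computes_nat_to_string A F \<and>
             (\<forall>n. length (F n) = n \<and> plain_complexity U (F n) \<ge> n)) \<longleftrightarrow>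
          (\<exists>D :: nat \<Rightarrow> nat. recursive_in A D \<and> DNR \<phi> D \<and>
             (\<exists>E. finite E \<and> range D \<subseteq> E)))"
    (is "(?lower \<longleftrightarrow> ?strings) \<and> (_ \<longleftrightarrow> ?dnr)")
proof -
  have "?lower \<Longrightarrow> ?strings"
    using complex_strings_from_lower_bound[of A _ U] by blast
  moreover have "?strings \<Longrightarrow> ?dnr"
    using DNR_from_complex_strings[OF assms, of A] by blast
  moreover have "?dnr \<Longrightarrow> ?lower"
    using lower_bound_from_DNR[OF assms, of A] by blast
  ultimately show ?thesis by argo
qed

end
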